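(* Let $\mathbb{X}$ be a real reflexive Banach space and $\mathbb{Y}$ any real Banach space. Let $T,A:\mathbb{X}\to\mathbb{Y}$ be compact linear operators such that for each $\lambda\in\mathbb{R}$, $M_{T+\lambda A}=D_{\lambda}\cup(-D_{\lambda})$, where $D_{\lambda}$ is a non-empty connected subset of $S_{\mathbb{X}}$. Let $\mathcal{O}$ denote the collection of all s.i.p. on $\mathbb{Y}$. Then $$\operatorname{dist}(T,\operatorname{span}\{A\})=\sup\{[Tx,y]:x\in S_{\mathbb{X}},\ y\in S_{\mathbb{Y}},\ [\cdot,\cdot]\in\mathcal{O},\ [Ax,y]=0\}.$$
   Context: All normed spaces are real; $S_{\mathbb{X}}=\{x\in\mathbb{X}:\|x\|=1\}$ and similarly $S_{\mathbb{Y}}$. For a bounded linear operator $S:\mathbb{X}\to\mathbb{Y}$, $M_S=\{x\in S_{\mathbb{X}}:\|Sx\|=\|S\|\}$. The distance is taken in the operator norm: $\operatorname{dist}(T,\operatorname{span}\{A\})=\inf_{\lambda\in\mathbb{R}}\|T+\lambda A\|$. A semi-inner-product (s.i.p.) on a real normed space $\mathbb{Y}$ is a function $[\cdot,\cdot]:\mathbb{Y}\times\mathbb{Y}\to\mathbb{R}$ such that for all $\alpha,\beta\in\mathbb{R}$ and $x,y,z\in\mathbb{Y}$: (a) $[\alpha x+\beta y,z]=\alpha[x,z]+\beta[y,z]$; (b) $[x,x]>0$ whenever $x\ne 0$; (c) $|[x,y]|^2\le[x,x][y,y]$; (d) $[x,\alpha y]=\alpha[x,y]$. Every s.i.p. is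 assumed compatible with the norm: $[x,x]=\|x\|^2$ for all $x$. In the supremum, the same s.i.p. is used in $[Tx,y]$ and $[Ax,y]$. *)

theory Defs
  imports "HOL-Analysis.Analysis"
begin

lift_definition canonical_embedding ::
    "'a::real_normed_vector \<Rightarrow> (('a \<Rightarrow>\<^sub>L real) \<Rightarrow>\<^sub>L real)"
  is "\<lambda>x f. blinfun_apply f x"
  by (rule bounded_linear_apply_blinfun)

definition reflexive_space :: "'a::real_normed_vector itself \<Rightarrow> bool" where
  "reflexive_space _ \<longleftrightarrow>
     surj (canonical_embedding :: 'a \<Rightarrow> (('a \<Rightarrow>\<^sub>L real) \<Rightarrow>\<^sub>L real))"

(* Compact linear operators are automatically bounded, so nothing is lost by
   carrying them in the type of bounded linear operators, whose norm is the
   operator norm. *)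
definition compact_operator ::
    "('a::real_normed_vector \<Rightarrow>\<^sub>L 'b::real_normed_vector) \<Rightarrow> bool" where
  "compact_operator T \<longleftrightarrow>
     (\<forall>S. bounded S \<longrightarrow> compact (closure (blinfun_apply T ` S)))"

definition norm_attainment_set ::
    "('a::real_normed_vector \<Rightarrow>\<^sub>L 'b::real_normed_vector) \<Rightarrow> 'a set" where
  "norm_attainment_set S = {x \<in> sphere 0 1. norm (S x) = norm S}"

definition semi_inner_product :: "('b::real_normed_vector \<Rightarrow> 'b \<Rightarrow> real) \<Rightarrow> bool" where
  "semi_inner_product p \<longleftrightarrow>
     (\<forall>\<alpha> \<beta> x y z. p (\<alpha> *\<^sub>R x + \<beta> *\<^sub>R y) z = \<alpha> * p x z + \<beta> * p y z) \<and>
     (\<forall>x. x \<noteq> 0 \<longrightarrow> p x x > 0) \<and>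
     (\<forall>x y. \<bar>p x y\<bar>\<^sup>2 \<le> p x x * p y y) \<and>
     (\<forall>\<alpha> x y. p x (\<alpha> *\<^sub>R y) = \<alpha> * p x y)"

definition compatible_sips :: "('b::real_normed_vector \<Rightarrow> 'b \<Rightarrow> real) set" where
  "compatible_sips = {p. semi_inner_product p \<and> (\<forall>x. p x x = (norm x)\<^sup>2)}"

definition sip_values ::
    "('a::real_normed_vector \<Rightarrow>\<^sub>L 'b::real_normed_vector) \<Rightarrow> ('a \<Rightarrow>\<^sub>L 'b) \<Rightarrow> real set" where
  "sip_values T A =
     {p (T x) y | x y p. x \<in> sphere 0 1 \<and> y \<in> sphere 0 1 \<and>
                          p \<in> compatible_sips \<and> p (A x) y = 0}"

(* The values of interest form a set symmetric about 0 (replace x by -x), so their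
   supremum lies in [0, \<infinity>), and the supremum of the empty set is 0 there.
   The set is empty if the codomain is {0}, or if domain and codomain are both
   one-dimensional and A is nonzero; the distance is then 0 as well. For sets of
   reals Sup {} carries no information, hence the case distinction. *)
definition Sup0 :: "real set \<Rightarrow> real" where
  "Sup0 V = (if V = {} then 0 else Sup V)"

lemma bdd_above_sip_values: "bdd_above (sip_values T A)"
proof (rule bdd_aboveI)
  fix v assume "v \<in> sip_values T A"
  then obtain x y p where v: "v = p (T x) y" and n: "norm x = 1" "norm y = 1"
    and p: "p \<in> compatible_sips"
    by (auto simp: sip_values_def)
  have "\<bar>v\<bar>\<^sup>2 \<le> p (T x) (T x) * p y y"
    using p v unfolding compatible_sips_def semi_inner_product_def by blast
  also have "\<dots> = (norm (T x))\<^sup>2"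
    using p n by (simp add: compatible_sips_def)
  finally have "\<bar>v\<bar> \<le> norm (T x)"
    by (rule power2_le_imp_le) simp
  also have "\<dots> \<le> norm T"
    using norm_blinfun[of T x] n by simp
  finally show "v \<le> norm T" by simp
qed

lemma uminus_in_sip_values:
  assumes "v \<in> sip_values T A"
  shows "- v \<in> sip_values T A"
proof -
  obtain x y p where v: "v = p (T x) y" "norm x = 1" "norm y = 1"
    "p \<in> compatible_sips" "p (A x) y = 0"
    using assms by (auto simp: sip_values_def)
  have "p (\<alpha> *\<^sub>R x + \<beta> *\<^sub>R y) z = \<alpha> * p x z + \<beta> * p y z" for \<alpha> \<beta> x y z
    using v(4) by (simp add: compatible_sips_def semi_inner_product_def)
  from this[of "-1" _ 0] have "p (- u) z = - p u z" for u z
    by simp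
  then show ?thesis
    unfolding sip_values_def using v
    by (intro CollectI exI[of _ "- x"] exI[of _ y] exI[of _ p]) (auto simp: blinfun.minus_right)
qed

lemma infdist_span_singleton:
  fixes T A :: "'a::real_normed_vector"
  shows "infdist T (span {A}) = (INF l. norm (T + l *\<^sub>R A))"
proof -
  have "dist T ` span {A} = range (\<lambda>l. norm (T - l *\<^sub>R A))"
    by (auto simp: span_singleton dist_norm)
  also have "\<dots> = range (\<lambda>l. norm (T + l *\<^sub>R A))"
  proof (intro equalityI image_subsetI)
    show "norm (T - l *\<^sub>R A) \<in> range (\<lambda>l. norm (T + l *\<^sub>R A))" for l
      by (rule range_eqI[of _ _ "- l"]) simp
    show "norm (T + l *\<^sub>R A) \<in> range (\<lambda>l. norm (T - l *\<^sub>R A))" for l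
      by (rule range_eqI[of _ _ "- l"]) simp
  qed
  moreover have "span {A} \<noteq> {}" using span_zero by blast
  ultimately show ?thesis by (simp add: infdist_def)
qed

end

theory Submission
  imports Defs
begin

text \<open>
  Every s.i.p. value is at most the norm of T + lA for each l, by the Cauchy--Schwarz
  condition (c). Conversely, let S = T + lA have minimal norm and suppose S is nonzero, so
  that S is Birkhoff--James orthogonal to A. If x(n) attains the norm of S + A/n, reflexivity
  and compactness give a subsequence along which S x(n) and A x(n) tend to S w and A w; then w
  attains the norm of S, and by convexity |Sw + tAw| is at least |Sw| for all t \<ge> 0. The same
  holds for -A. The norm attainers satisfying one of these two one-sided conditions form two
  closed symmetric sets, which cover the connected set D and both meet it, so some x in D
  satisfies both. A norming functional of Sx that annihilates Ax exists by Hahn--Banach, and it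
  is the functional [_, Sx/|Sx|] of some s.i.p.; this s.i.p. realises the distance.
\<close>

section \<open>Sublinear functionals and the Hahn-Banach theorem\<close>

definition sublinear :: "('v::real_vector \<Rightarrow> real) \<Rightarrow> bool" where
  "sublinear p \<longleftrightarrow>
     (\<forall>x y. p (x + y) \<le> p x + p y) \<and> (\<forall>c\<ge>0. \<forall>x. p (c *\<^sub>R x) = c * p x)"

lemma sublinearD:
  assumes "sublinear p"
  shows "p (x + y) \<le> p x + p y" and "c \<ge> 0 \<Longrightarrow> p (c *\<^sub>R x) = c * p x"
  using assms by (auto simp: sublinear_def)

lemma sublinear_0: "sublinear p \<Longrightarrow> p 0 = 0"
  using sublinearD(2)[of p 0 0] by simp

lemma sublinear_ge: "sublinear p \<Longrightarrow> - p (- x) \<le> p x"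
  using sublinearD(1)[of p x "- x"] sublinear_0[of p] by simp

text \<open>One inequality suffices for homogeneity: applied with \<open>inverse c\<close> to
  \<open>c *\<^sub>R x\<close> it gives the reverse one.\<close>

lemma sublinearI:
  assumes "\<And>x y. p (x + y) \<le> p x + p y"
    and "p 0 = 0"
    and "\<And>c x. c > 0 \<Longrightarrow> p (c *\<^sub>R x) \<le> c * p x"
  shows "sublinear p"
  unfolding sublinear_def
proof (intro conjI allI impI)
  fix c :: real and x assume "0 \<le> c"
  show "p (c *\<^sub>R x) = c * p x"
  proof (cases "c = 0")
    case False
    with \<open>0 \<le> c\<close> have c: "c > 0" by simp
    have "p x \<le> inverse c * p (c *\<^sub>R x)"
      using assms(3)[of "inverse c" "c *\<^sub>R x"] c by simp
    with c have "c * p x \<le> p (c *\<^sub>R x)"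
      by (simp add: field_simps)
    with assms(3)[OF c] show ?thesis by (simp add: antisym)
  qed (use assms(2) in simp)
qed (rule assms(1))

lemma sublinear_norm: "sublinear norm"
  by (auto simp: sublinear_def norm_triangle_ineq)

text \<open>Under the assumptions of the locale below, this is the largest sublinear functional
  below \<open>p\<close> whose value at \<open>- m\<close> is at most \<open>- f m\<close> for each
  \<open>m\<close> in \<open>C\<close>.\<close>

definition cone_minorant ::
    "('v::real_vector \<Rightarrow> real) \<Rightarrow> 'v set \<Rightarrow> ('v \<Rightarrow> real) \<Rightarrow> 'v \<Rightarrow> real" where
  "cone_minorant p C f x = (INF m\<in>C. p (x + m) - f m)"

text \<open>A superlinear \<open>f\<close> on a convex cone, dominated by \<open>p\<close>. One
  format serves every later use: a ray with \<open>p\<close> itself, a line with the zero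
  functional, and a subspace of functionals on which a limit exists.\<close>

locale dominated_on_cone =
  fixes p :: "'v::real_vector \<Rightarrow> real" and C :: "'v set" and f :: "'v \<Rightarrow> real"
  assumes sublin: "sublinear p"
    and zero_mem: "0 \<in> C"
    and add_mem: "\<And>x y. x \<in> C \<Longrightarrow> y \<in> C \<Longrightarrow> x + y \<in> C"
    and scale_mem: "\<And>c x. c > 0 \<Longrightarrow> x \<in> C \<Longrightarrow> c *\<^sub>R x \<in> C"
    and superadd: "\<And>x y. x \<in> C \<Longrightarrow> y \<in> C \<Longrightarrow> f x + f y \<le> f (x + y)"
    and homog: "\<And>c x. c > 0 \<Longrightarrow> x \<in> C \<Longrightarrow> f (c *\<^sub>R x) = c * f x"
    and dominated: "\<And>x. x \<in> C \<Longrightarrow> f x \<le> p x"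
    and f_zero: "f 0 = 0"
begin

text \<open>Follows from \<open>f m \<le> p m \<le> p (- x) + p (x + m)\<close>. The bound does not
  depend on \<open>m\<close>, so the infimum in \<open>cone_minorant\<close> is finite.\<close>

lemma minorant_term_ge: "m \<in> C \<Longrightarrow> - p (- x) \<le> p (x + m) - f m"
  using sublinearD(1)[OF sublin, of "- x" "x + m"] dominated[of m] by simp

lemma cone_minorant_le: "m \<in> C \<Longrightarrow> cone_minorant p C f x \<le> p (x + m) - f m"
  unfolding cone_minorant_def
  by (rule cINF_lower) (auto intro!: bdd_belowI minorant_term_ge)

lemma cone_minorant_greatest:
  "(\<And>m. m \<in> C \<Longrightarrow> b \<le> p (x + m) - f m) \<Longrightarrow> b \<le> cone_minorant p C f x"
  unfolding cone_minorant_def using zero_mem by (intro cINF_greatest) auto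

lemma cone_minorant_le_self: "cone_minorant p C f x \<le> p x"
  using cone_minorant_le[OF zero_mem] f_zero by simp

lemma cone_minorant_uminus_le: "m \<in> C \<Longrightarrow> cone_minorant p C f (- m) \<le> - f m"
  using cone_minorant_le[of m "- m"] sublinear_0[OF sublin] by simp

text \<open>Subadditivity: the terms for \<open>m\<close> at \<open>x\<close> and \<open>n\<close>
  at \<open>y\<close> together dominate the term for \<open>m + n\<close> at \<open>x + y\<close>;
  infima are then taken over \<open>n\<close> and over \<open>m\<close>. Homogeneity: scaling
  \<open>x\<close> and \<open>m\<close> together scales the term.\<close>

lemma sublinear_cone_minorant: "sublinear (cone_minorant p C f)"
proof (rule sublinearI)
  let ?q = "cone_minorant p C f"
  fix x y
  have 1: "?q (x + y) \<le> (p (x + m) - f m) + (p (y + n) - f n)" if "m \<in> C" "n \<in> C" for m n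
  proof -
    have "?q (x + y) \<le> p ((x + m) + (y + n)) - f (m + n)"
      using cone_minorant_le[OF add_mem[OF that], of "x + y"] by (simp add: algebra_simps)
    with sublinearD(1)[OF sublin, of "x + m" "y + n"] superadd[OF that] show ?thesis by simp
  qed
  have "?q (x + y) - (p (x + m) - f m) \<le> ?q y" if "m \<in> C" for m
    by (rule cone_minorant_greatest) (use 1[OF that] in \<open>simp add: algebra_simps\<close>)
  then have "?q (x + y) - ?q y \<le> ?q x"
    by (intro cone_minorant_greatest) (simp add: algebra_simps)
  then show "?q (x + y) \<le> ?q x + ?q y" by simp
next
  show "cone_minorant p C f 0 = 0"
  proof (rule antisym)
    show "cone_minorant p C f 0 \<le> 0"
      using cone_minorant_le_self[of 0] sublinear_0[OF sublin] by simp
    show "0 \<le> cone_minorant p C f 0"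
      by (rule cone_minorant_greatest) (use dominated in simp)
  qed
next
  fix c :: real and x assume c: "c > 0"
  let ?q = "cone_minorant p C f"
  have "?q (c *\<^sub>R x) / c \<le> p (x + m) - f m" if m: "m \<in> C" for m
  proof -
    have "?q (c *\<^sub>R x) \<le> p (c *\<^sub>R (x + m)) - f (c *\<^sub>R m)"
      using cone_minorant_le[OF scale_mem[OF c m], of "c *\<^sub>R x"] by (simp add: scaleR_add_right)
    also have "\<dots> = c * (p (x + m) - f m)"
      using c homog[OF c m] sublinearD(2)[OF sublin, of c "x + m"] by (simp add: algebra_simps)
    finally show ?thesis using c by (simp add: field_simps)
  qed
  then have "?q (c *\<^sub>R x) / c \<le> ?q x" by (rule cone_minorant_greatest)
  then show "?q (c *\<^sub>R x) \<le> c * ?q x" using c by (simp add: field_simps)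
qed

end

text \<open>By positive homogeneity \<open>p\<close> is additive on a single ray, hence superlinear
  there.\<close>

lemma dominated_on_ray:
  assumes "sublinear p"
  shows "dominated_on_cone p {t *\<^sub>R y |t. t \<ge> 0} p"
proof
  show "x + z \<in> {t *\<^sub>R y |t. t \<ge> 0}" if "x \<in> {t *\<^sub>R y |t. t \<ge> 0}" "z \<in> {t *\<^sub>R y |t. t \<ge> 0}" for x z
  proof -
    from that obtain s t where "x = s *\<^sub>R y" "z = t *\<^sub>R y" "s \<ge> 0" "t \<ge> 0" by auto
    then show ?thesis by (auto simp flip: scaleR_add_left intro!: exI[of _ "s + t"])
  qed
  show "p x + p z \<le> p (x + z)" if "x \<in> {t *\<^sub>R y |t. t \<ge> 0}" "z \<in> {t *\<^sub>R y |t. t \<ge> 0}" for x z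
  proof -
    from that obtain s t where "x = s *\<^sub>R y" "z = t *\<^sub>R y" "s \<ge> 0" "t \<ge> 0" by auto
    then show ?thesis
      using assms by (simp add: sublinearD(2) distrib_right flip: scaleR_add_left)
  qed
  show "c *\<^sub>R x \<in> {t *\<^sub>R y |t. t \<ge> 0}" if "c > 0" "x \<in> {t *\<^sub>R y |t. t \<ge> 0}" for c x
  proof -
    from that obtain s where "x = s *\<^sub>R y" "s \<ge> 0" by auto
    with that show ?thesis by (auto intro!: exI[of _ "c * s"])
  qed
qed (use assms in \<open>auto simp: sublinearD(2) sublinear_0 intro: exI[of _ 0]\<close>)

text \<open>Minorizing q along the ray of y changes nothing, which forces q (x + y) \<ge> q x + q y.\<close>
lemma minimal_sublinear_linear:
  fixes q :: "'v::real_vector \<Rightarrow> real"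
  assumes q: "sublinear q"
    and minimal: "\<And>r. sublinear r \<Longrightarrow> (\<And>x. r x \<le> q x) \<Longrightarrow> r = q"
  shows "linear q"
proof -
  have add: "q (x + y) = q x + q y" for x y
  proof -
    let ?C = "{t *\<^sub>R y |t. t \<ge> 0}"
    interpret dominated_on_cone q ?C q using q by (rule dominated_on_ray)
    have "cone_minorant q ?C q = q"
      using sublinear_cone_minorant cone_minorant_le_self by (rule minimal)
    moreover have "y \<in> ?C" by (auto intro!: exI[of _ 1])
    ultimately have "q x \<le> q (x + y) - q y" using cone_minorant_le[of y x] by simp
    with sublinearD(1)[OF q, of x y] show ?thesis by simp
  qed
  have minus: "q (- x) = - q x" for x
    using add[of x "- x"] sublinear_0[OF q] by simp
  have "q (c *\<^sub>R x) = c * q x" for c x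
  proof (cases "c \<ge> 0")
    case False
    then have "q (c *\<^sub>R x) = - q ((- c) *\<^sub>R x)" using minus[of "(- c) *\<^sub>R x"] by simp
    also have "\<dots> = c * q x" using False by (simp only: sublinearD(2)[OF q, of "- c" x])
    finally show ?thesis .
  qed (use sublinearD(2)[OF q] in simp)
  with add show ?thesis by (intro linearI) auto
qed

text \<open>Supplies the chain bounds for Zorn's lemma. The common majorant \<open>p\<close> keeps
  the infimum finite, since \<open>- p (- x) \<le> - q (- x) \<le> q x\<close>.\<close>

lemma sublinear_INF_chain:
  fixes Q :: "('v::real_vector \<Rightarrow> real) set"
  assumes ne: "Q \<noteq> {}"
    and sub: "\<And>q. q \<in> Q \<Longrightarrow> sublinear q \<and> (\<forall>x. q x \<le> p x)"
    and chain: "\<And>q r. q \<in> Q \<Longrightarrow> r \<in> Q \<Longrightarrow> (\<forall>x. q x \<le> r x) \<or> (\<forall>x. r x \<le> q x)"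
  shows "sublinear (\<lambda>x. INF q\<in>Q. q x)" and "q \<in> Q \<Longrightarrow> (INF q\<in>Q. q x) \<le> q x"
proof -
  have lb: "- p (- x) \<le> q x" if "q \<in> Q" for q x
    using sub[OF that] sublinear_ge[of q x] by (metis neg_le_iff_le order_trans)
  have lower: "(INF q\<in>Q. q x) \<le> q x" if "q \<in> Q" for q x
    using that by (intro cINF_lower bdd_belowI[of _ "- p (- x)"]) (auto intro: lb)
  then show "q \<in> Q \<Longrightarrow> (INF q\<in>Q. q x) \<le> q x" .
  show "sublinear (\<lambda>x. INF q\<in>Q. q x)"
  proof (rule sublinearI)
    fix x y
    have 1: "(INF q\<in>Q. q (x + y)) \<le> q x + r y" if qr: "q \<in> Q" "r \<in> Q" for q r
    proof -
      \<comment> \<open>The smaller of \<open>q\<close> and \<open>r\<close> is below both at both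
        points; this is where the chain condition enters.\<close>
      obtain s where "s \<in> Q" "s x \<le> q x" "s y \<le> r y"
        using chain[OF qr] qr by auto
      moreover from this have "s (x + y) \<le> s x + s y" using sub sublinearD(1) by blast
      ultimately show ?thesis using lower[of s "x + y"] by linarith
    qed
    have "(INF q\<in>Q. q (x + y)) - q x \<le> (INF r\<in>Q. r y)" if "q \<in> Q" for q
      using ne by (intro cINF_greatest) (use 1[OF that] in \<open>auto simp: algebra_simps\<close>)
    then have "(INF q\<in>Q. q (x + y)) - (INF r\<in>Q. r y) \<le> (INF q\<in>Q. q x)"
      using ne by (intro cINF_greatest) (auto simp: algebra_simps)
    then show "(INF q\<in>Q. q (x + y)) \<le> (INF q\<in>Q. q x) + (INF q\<in>Q. q y)" by simp
  next
    have "(\<lambda>q. q 0) ` Q = {0}" using ne sub sublinear_0 by force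
    then show "(INF q\<in>Q. q 0) = 0" by simp
  next
    fix c :: real and x assume c: "c > 0"
    have "(INF q\<in>Q. q (c *\<^sub>R x)) / c \<le> q x" if "q \<in> Q" for q
      using lower[OF that, of "c *\<^sub>R x"] sublinearD(2)[of q c x] sub[OF that] c
      by (simp add: field_simps)
    then have "(INF q\<in>Q. q (c *\<^sub>R x)) / c \<le> (INF q\<in>Q. q x)"
      using ne by (intro cINF_greatest) auto
    then show "(INF q\<in>Q. q (c *\<^sub>R x)) \<le> c * (INF q\<in>Q. q x)" using c by (simp add: field_simps)
  qed
qed

text \<open>Zorn's lemma yields a minimal sublinear functional below \<open>p\<close>, and minimal
  ones are linear.\<close>

lemma linear_below_sublinear:
  fixes p :: "'v::real_vector \<Rightarrow> real"
  assumes p: "sublinear p"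
  obtains g where "linear g" "\<And>x. g x \<le> p x"
proof -
  define A where "A = {q. sublinear q \<and> (\<forall>x. q x \<le> p x)}"
  \<comment> \<open>Reversed order: Zorn yields a minimal element of \<^term>\<open>A\<close>.\<close>
  define P :: "('v \<Rightarrow> real) \<Rightarrow> ('v \<Rightarrow> real) \<Rightarrow> bool" where "P = (\<lambda>q r. \<forall>x. r x \<le> q x)"
  have "\<exists>m\<in>A. \<forall>a\<in>A. P m a \<longrightarrow> a = m"
  proof (rule predicate_Zorn)
    show "partial_order_on A (relation_of P A)"
      by (rule partial_order_on_relation_ofI) (auto simp: P_def fun_eq_iff antisym, meson order_trans)
    fix Q assume "Q \<in> Chains (relation_of P A)"
    then have QA: "Q \<subseteq> A" and chain: "\<And>q r. q \<in> Q \<Longrightarrow> r \<in> Q \<Longrightarrow> (\<forall>x. q x \<le> r x) \<or> (\<forall>x. r x \<le> q x)"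
      by (auto simp: Chains_def relation_of_def P_def)
    show "\<exists>u\<in>A. \<forall>a\<in>Q. P a u"
    proof (cases "Q = {}")
      case True
      with p show ?thesis by (auto simp: A_def)
    next
      case False
      have sub: "\<And>q. q \<in> Q \<Longrightarrow> sublinear q \<and> (\<forall>x. q x \<le> p x)" using QA by (auto simp: A_def)
      let ?u = "\<lambda>x. INF q\<in>Q. q x"
      have le: "?u x \<le> q x" if "q \<in> Q" for q x
        using sub chain that by (rule sublinear_INF_chain(2)[OF False])
      from False obtain q where q: "q \<in> Q" by auto
      have "?u x \<le> p x" for x
        by (rule order_trans[OF le[OF q]]) (use sub[OF q] in blast)
      moreover have "sublinear ?u"
        using sub chain by (rule sublinear_INF_chain(1)[OF False])
      ultimately have "?u \<in> A" by (simp add: A_def)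
      moreover have "P a ?u" if "a \<in> Q" for a
        unfolding P_def using le[OF that] by blast
      ultimately show ?thesis by blast
    qed
  qed
  then obtain m where "sublinear m" "\<And>x. m x \<le> p x"
    and min: "\<And>r. r \<in> A \<Longrightarrow> P m r \<Longrightarrow> r = m"
    by (auto simp: A_def)
  moreover have "linear m"
  proof (rule minimal_sublinear_linear)
    \<comment> \<open>Whatever lies below \<open>m\<close> lies below \<open>p\<close>, so
      minimality within \<open>A\<close> is minimality among all sublinear functionals.\<close>
    fix r assume r: "sublinear r" "\<And>x. r x \<le> m x"
    show "r = m"
    proof (rule min)
      show "P m r" using r(2) by (simp add: P_def)
      show "r \<in> A"
        unfolding A_def using r(1) order_trans[OF r(2) \<open>\<And>x. m x \<le> p x\<close>] by blast
    qed
  qed fact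
  ultimately show ?thesis using that by blast
qed

text \<open>For a linear \<open>g\<close> below the cone minorant, the upper bound
  \<open>- f m\<close> at \<open>- m\<close> becomes the lower bound \<open>f m\<close> for
  \<open>g m\<close>.\<close>

lemma (in dominated_on_cone) Hahn_Banach:
  obtains g where "linear g" "\<And>x. g x \<le> p x" "\<And>m. m \<in> C \<Longrightarrow> f m \<le> g m"
proof -
  obtain g where g: "linear g" "\<And>x. g x \<le> cone_minorant p C f x"
    using linear_below_sublinear[OF sublinear_cone_minorant] by blast
  have "f m \<le> g m" if "m \<in> C" for m
    using g(2)[of "- m"] cone_minorant_uminus_le[OF that] linear_neg[OF g(1), of m] by simp
  moreover have "g x \<le> p x" for x using g(2) cone_minorant_le_self order_trans by blast
  ultimately show ?thesis using g(1) that by blast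
qed

section \<open>Norming functionals\<close>

lemma blinfun_of_linear_le_norm:
  fixes g :: "'v::real_normed_vector \<Rightarrow> real"
  assumes "linear g" "\<And>x. g x \<le> norm x"
  obtains h :: "'v \<Rightarrow>\<^sub>L real" where "norm h \<le> 1" "\<And>x. h x = g x"
proof -
  have abs: "norm (g x) \<le> norm x" for x
    using assms(2)[of x] assms(2)[of "- x"] linear_neg[OF assms(1), of x] by auto
  have "bounded_linear g"
    using assms(1) abs by (intro bounded_linear_intro[where K = 1])
      (auto simp: linear_add linear_scale)
  then have app: "blinfun_apply (Blinfun g) x = g x" for x by (simp add: bounded_linear_Blinfun_apply)
  have "norm (Blinfun g) \<le> 1"
    by (rule norm_blinfun_bound) (use abs app in auto)
  with app show ?thesis using that by blast
qed

lemma support_functional_exists: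
  fixes u :: "'v::real_normed_vector"
  obtains h :: "'v \<Rightarrow>\<^sub>L real" where "norm h \<le> 1" "h u = norm u"
proof -
  interpret dominated_on_cone norm "{t *\<^sub>R u |t. t \<ge> 0}" norm
    by (rule dominated_on_ray[OF sublinear_norm])
  obtain g where g: "linear g" "\<And>x. g x \<le> norm x"
      "\<And>m. m \<in> {t *\<^sub>R u |t. t \<ge> 0} \<Longrightarrow> norm m \<le> g m"
    using Hahn_Banach by blast
  have "norm u \<le> g u" by (rule g(3)) (auto intro!: exI[of _ 1])
  with g(2)[of u] have "g u = norm u" by simp
  then show ?thesis using blinfun_of_linear_le_norm[OF g(1,2)] that by metis
qed

text \<open>The norm is first replaced by the distance to the line of \<open>v\<close>, which by
  orthogonality is still \<open>norm u\<close> at \<open>u\<close>; Hahn-Banach is then applied to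
  this distance on the ray of \<open>u\<close>. A linear functional below the distance vanishes at
  \<open>v\<close>.\<close>

lemma orthogonal_support_functional:
  fixes u v :: "'v::real_normed_vector"
  assumes orth: "\<And>t. norm u \<le> norm (u + t *\<^sub>R v)"
  obtains h :: "'v \<Rightarrow>\<^sub>L real" where "norm h \<le> 1" "h u = norm u" "h v = 0"
proof -
  interpret V: dominated_on_cone norm "range (\<lambda>t. t *\<^sub>R v)" "\<lambda>_. 0"
  proof
    show "x + y \<in> range (\<lambda>t. t *\<^sub>R v)" if "x \<in> range (\<lambda>t. t *\<^sub>R v)" "y \<in> range (\<lambda>t. t *\<^sub>R v)" for x y
      using that by (auto simp flip: scaleR_add_left)
    show "0 \<in> range (\<lambda>t. t *\<^sub>R v)" by (rule range_eqI[of _ _ 0]) simp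
  qed (auto simp: sublinear_norm)
  let ?q = "cone_minorant norm (range (\<lambda>t. t *\<^sub>R v)) (\<lambda>_. 0)"
  interpret U: dominated_on_cone ?q "{t *\<^sub>R u |t. t \<ge> 0}" ?q
    by (rule dominated_on_ray[OF V.sublinear_cone_minorant])
  obtain g where g: "linear g" "\<And>x. g x \<le> ?q x"
      "\<And>m. m \<in> {t *\<^sub>R u |t. t \<ge> 0} \<Longrightarrow> ?q m \<le> g m"
    using U.Hahn_Banach by blast
  have gn: "g x \<le> norm x" for x using g(2) V.cone_minorant_le_self order_trans by blast
  have "norm u \<le> ?q u" by (rule V.cone_minorant_greatest) (use orth in auto)
  also have "\<dots> \<le> g u" by (rule g(3)) (auto intro!: exI[of _ 1])
  finally have gu: "g u = norm u" using gn[of u] by simp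
  have "- v \<in> range (\<lambda>t. t *\<^sub>R v)" by (rule range_eqI[of _ _ "- 1"]) simp
  then have "g v \<le> 0"
    using g(2)[of v] V.cone_minorant_uminus_le[of "- v"] by simp
  moreover have "v \<in> range (\<lambda>t. t *\<^sub>R v)" by (rule range_eqI[of _ _ 1]) simp
  then have "g (- v) \<le> 0"
    using g(2)[of "- v"] V.cone_minorant_uminus_le[of v] by simp
  ultimately have gv: "g v = 0" using linear_neg[OF g(1), of v] by simp
  show ?thesis using blinfun_of_linear_le_norm[OF g(1) gn] gu gv that by metis
qed


section \<open>Semi-inner-products from norming functionals\<close>

lemma semi_inner_product_with_functional:
  fixes h :: "'b::real_normed_vector \<Rightarrow>\<^sub>L real"
  assumes h: "norm h \<le> 1" and y: "h y = norm y" "norm y = 1"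
  obtains p where "p \<in> compatible_sips" "\<And>x. p x y = h x"
proof -
  \<comment> \<open>The choice of support functional depends only on the line through the vector,
    which makes the s.i.p. homogeneous in its second argument.\<close>
  define G :: "'b set \<Rightarrow> ('b \<Rightarrow>\<^sub>L real)" where
    "G L = (if L = span {y} then h
            else SOME g. norm g \<le> 1 \<and> (\<forall>z\<in>L. \<bar>blinfun_apply g z\<bar> = norm z))" for L
  \<comment> \<open>A functional norming one vector norms every vector on its line up to sign, so a
    choice per line is possible.\<close>
  have line: "\<forall>z\<in>span {u}. \<bar>g z\<bar> = norm z" if "g u = norm u" for g :: "'b \<Rightarrow>\<^sub>L real" and u
    using that by (auto simp: span_singleton blinfun.scaleR_right abs_mult)
  have G: "norm (G (span {u})) \<le> 1 \<and> (\<forall>z\<in>span {u}. \<bar>G (span {u}) z\<bar> = norm z)" for u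
  proof (cases "span {u} = span {y}")
    case True
    then show ?thesis using h line[OF y(1)] by (simp add: G_def)
  next
    case False
    obtain g :: "'b \<Rightarrow>\<^sub>L real" where "norm g \<le> 1" "g u = norm u"
      by (rule support_functional_exists)
    with line[of g u] have "\<exists>g. norm g \<le> 1 \<and> (\<forall>z\<in>span {u}. \<bar>blinfun_apply g z\<bar> = norm z)"
      by blast
    from someI_ex[OF this] False show ?thesis by (simp add: G_def)
  qed
  have G_le: "\<bar>G (span {u}) x\<bar> \<le> norm x" for u x
    using norm_blinfun[of "G (span {u})" x] G[of u]
      mult_right_mono[of "norm (G (span {u}))" 1 "norm x"] by simp
  have G_self: "\<bar>G (span {u}) u\<bar> = norm u" for u
    using G[of u] by (simp add: span_base)
  \<comment> \<open>The first factor has absolute value \<open>norm z\<close> and carries the sign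
    that makes \<open>p z z\<close> nonnegative.\<close>
  define p where "p x z = G (span {z}) z * G (span {z}) x" for x z
  have self: "p x x = (norm x)\<^sup>2" for x
    using G_self[of x] by (metis p_def power2_abs power2_eq_square)
  have "semi_inner_product p"
    unfolding semi_inner_product_def
  proof (intro conjI allI impI)
    show "p (\<alpha> *\<^sub>R x + \<beta> *\<^sub>R y) z = \<alpha> * p x z + \<beta> * p y z" for \<alpha> \<beta> x y z
      by (simp add: p_def blinfun.add_right blinfun.scaleR_right algebra_simps)
    show "0 < p x x" if "x \<noteq> 0" for x
      using that by (simp add: self)
    show "\<bar>p x z\<bar>\<^sup>2 \<le> p x x * p z z" for x z
    proof -
      have "\<bar>p x z\<bar> \<le> norm z * norm x"
        using G_le[of z x] G_self[of z] by (simp add: p_def abs_mult mult_left_mono)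
      then have "\<bar>p x z\<bar>\<^sup>2 \<le> (norm z * norm x)\<^sup>2" by (rule power_mono) simp
      then show ?thesis by (simp add: self power_mult_distrib mult.commute)
    qed
    show "p x (\<alpha> *\<^sub>R z) = \<alpha> * p x z" for \<alpha> x z
    proof (cases "\<alpha> = 0")
      \<comment> \<open>A nonzero multiple spans the same line, so \<open>G\<close> selects the same
        functional; only the first factor is scaled.\<close>
      case False
      have "span {\<alpha> *\<^sub>R z} = span {z}"
      proof
        show "span {\<alpha> *\<^sub>R z} \<subseteq> span {z}"
          by (intro span_minimal) (auto intro: span_scale span_base)
        have "inverse \<alpha> *\<^sub>R (\<alpha> *\<^sub>R z) \<in> span {\<alpha> *\<^sub>R z}" by (intro span_scale span_base) simp
        with False show "span {z} \<subseteq> span {\<alpha> *\<^sub>R z}" by (intro span_minimal) auto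
      qed
      then show ?thesis by (simp add: p_def blinfun.scaleR_right)
    qed (simp add: p_def blinfun.zero_right)
  qed
  moreover have "p x y = h x" for x using y by (simp add: p_def G_def)
  ultimately show ?thesis using that[of p] self by (simp add: compatible_sips_def)
qed

section \<open>Limits of operator values from reflexivity and compactness\<close>

text \<open>
  Replaces weak sequential compactness of the ball: the limit of evaluation at x(n) is defined
  on the functionals factoring through K; its Hahn--Banach extension is evaluation at w.
\<close>
lemma reflexive_cball_image_limit:
  fixes K :: "'a::real_normed_vector \<Rightarrow>\<^sub>L 'z::real_normed_vector"
  assumes refl: "reflexive_space TYPE('a)"
    and x: "\<And>n. norm (x n) \<le> 1"
    and lim: "(\<lambda>n. K (x n)) \<longlonglongrightarrow> z"
  obtains w where "norm w \<le> 1" "K w = z"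
proof -
  define C where "C = range (\<lambda>g :: 'z \<Rightarrow>\<^sub>L real. g o\<^sub>L K)"
  \<comment> \<open>Only the values on \<open>C\<close> are used, where the limit exists; elsewhere
    \<open>Lim\<close> may be arbitrary.\<close>
  define \<phi> :: "('a \<Rightarrow>\<^sub>L real) \<Rightarrow> real" where "\<phi> h = Lim sequentially (\<lambda>n. h (x n))" for h
  have conv: "(\<lambda>n. (g o\<^sub>L K) (x n)) \<longlonglongrightarrow> g z" for g :: "'z \<Rightarrow>\<^sub>L real"
    using blinfun.tendsto[OF tendsto_const lim] by simp
  have \<phi>: "\<phi> (g o\<^sub>L K) = g z" for g :: "'z \<Rightarrow>\<^sub>L real"
    unfolding \<phi>_def by (rule tendsto_Lim[OF _ conv]) simp
  have sum: "(g o\<^sub>L K) + (g' o\<^sub>L K) = (g + g') o\<^sub>L K" for g g' :: "'z \<Rightarrow>\<^sub>L real"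
    by (rule blinfun_eqI) (simp add: blinfun.add_left)
  have scale: "c *\<^sub>R (g o\<^sub>L K) = (c *\<^sub>R g) o\<^sub>L K" for c and g :: "'z \<Rightarrow>\<^sub>L real"
    by (rule blinfun_eqI) (simp add: blinfun.scaleR_left)
  have zero: "0 = (0 :: 'z \<Rightarrow>\<^sub>L real) o\<^sub>L K"
    by (rule blinfun_eqI) simp
  interpret dominated_on_cone norm C \<phi>
  proof
    show "sublinear (norm :: ('a \<Rightarrow>\<^sub>L real) \<Rightarrow> real)" by (rule sublinear_norm)
    show "0 \<in> C" unfolding C_def using zero by (rule range_eqI)
    show "h + h' \<in> C" if "h \<in> C" "h' \<in> C" for h h' using that by (auto simp: C_def sum)
    show "c *\<^sub>R h \<in> C" if "h \<in> C" for c h using that by (auto simp: C_def scale)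
    show "\<phi> h + \<phi> h' \<le> \<phi> (h + h')" if "h \<in> C" "h' \<in> C" for h h'
      using that by (auto simp: C_def sum \<phi> blinfun.add_left)
    show "\<phi> (c *\<^sub>R h) = c * \<phi> h" if "h \<in> C" for c h
      using that by (auto simp: C_def scale \<phi> blinfun.scaleR_left)
    show "\<phi> 0 = 0" using \<phi>[of 0] by (simp flip: zero)
    show "\<phi> h \<le> norm h" if "h \<in> C" for h
    proof -
      from that obtain g where h: "h = g o\<^sub>L K" by (auto simp: C_def)
      have "h (x n) \<le> norm h" for n
        using norm_blinfun[of h "x n"] mult_left_mono[OF x[of n], of "norm h"] by simp
      then have "g z \<le> norm h" using conv[of g] h by (intro LIMSEQ_le_const2) auto
      then show ?thesis by (simp add: h \<phi>)
    qed
  qed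
  obtain g where g: "linear g" "\<And>h. g h \<le> norm h" "\<And>h. h \<in> C \<Longrightarrow> \<phi> h \<le> g h"
    using Hahn_Banach by blast
  obtain F :: "('a \<Rightarrow>\<^sub>L real) \<Rightarrow>\<^sub>L real" where F: "\<And>h. F h = g h"
    using blinfun_of_linear_le_norm[OF g(1,2)] by blast
  obtain w where "F = canonical_embedding w"
    using refl by (auto simp: reflexive_space_def dest: surjD)
  then have w: "h w = g h" for h :: "'a \<Rightarrow>\<^sub>L real"
    using F[of h] by (simp add: canonical_embedding.rep_eq)
  have "norm w \<le> 1"
  proof -
    obtain h :: "'a \<Rightarrow>\<^sub>L real" where "norm h \<le> 1" "h w = norm w" by (rule support_functional_exists)
    with w[of h] g(2)[of h] show ?thesis by simp
  qed
  moreover have "K w = z"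
  proof -
    \<comment> \<open>A functional norming \<open>z - K w\<close> tests equality, so the one-sided
      bound \<open>\<phi> h \<le> g h\<close> on \<open>C\<close> is enough.\<close>
    obtain k :: "'z \<Rightarrow>\<^sub>L real" where k: "k (z - K w) = norm (z - K w)"
      using support_functional_exists[of "z - K w"] by metis
    have "k z \<le> k (K w)"
      using g(3)[of "k o\<^sub>L K"] w[of "k o\<^sub>L K"] \<phi>[of k] by (simp add: C_def)
    then have "k (z - K w) \<le> 0" by (simp add: blinfun.diff_right)
    then have "norm (z - K w) \<le> 0" by (simp only: k)
    then show ?thesis by (simp only: norm_le_zero_iff right_minus_eq)
  qed
  ultimately show ?thesis using that by blast
qed

text \<open>The image of a bounded set lies in the continuous image of a product of two compact
  sets, which is compact and hence closed.\<close>

lemma compact_operator_add_scaleR: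
  fixes T A :: "'a::real_normed_vector \<Rightarrow>\<^sub>L 'b::real_normed_vector"
  assumes T: "compact_operator T" and A: "compact_operator A"
  shows "compact_operator (T + c *\<^sub>R A)"
  unfolding compact_operator_def
proof (intro allI impI)
  fix U :: "'a set" assume U: "bounded U"
  let ?X = "closure (T ` U)" and ?Y = "closure (A ` U)"
  have "compact ((\<lambda>(x, y). x + c *\<^sub>R y) ` (?X \<times> ?Y))"
    using T A U by (intro compact_continuous_image compact_Times)
      (auto simp: compact_operator_def case_prod_beta intro!: continuous_intros)
  moreover have "(T + c *\<^sub>R A) ` U \<subseteq> (\<lambda>(x, y). x + c *\<^sub>R y) ` (?X \<times> ?Y)"
  proof
    fix z assume "z \<in> (T + c *\<^sub>R A) ` U"
    then obtain u where "u \<in> U" "z = T u + c *\<^sub>R A u"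
      by (auto simp: blinfun.add_left blinfun.scaleR_left)
    then show "z \<in> (\<lambda>(x, y). x + c *\<^sub>R y) ` (?X \<times> ?Y)"
      by (intro image_eqI[of _ _ "(T u, A u)"]) (auto intro: closure_subset[THEN subsetD])
  qed
  ultimately have "closure ((T + c *\<^sub>R A) ` U) \<subseteq> (\<lambda>(x, y). x + c *\<^sub>R y) ` (?X \<times> ?Y)"
    and "compact ((\<lambda>(x, y). x + c *\<^sub>R y) ` (?X \<times> ?Y))"
    by (simp_all add: closure_minimal compact_imp_closed)
  then show "compact (closure ((T + c *\<^sub>R A) ` U))"
    by (metis closed_closure compact_Int_closed inf.absorb_iff2)
qed

text \<open>Pairing \<open>S\<close> and \<open>A\<close> into one operator with values in the
  product space gives a single \<open>w\<close> for both limits.\<close>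

lemma compact_operators_common_limit:
  fixes S A :: "'a::real_normed_vector \<Rightarrow>\<^sub>L 'b::real_normed_vector"
  assumes refl: "reflexive_space TYPE('a)"
    and S: "compact_operator S" and A: "compact_operator A"
    and x: "\<And>n. norm (x n) \<le> 1"
  obtains w r where "norm w \<le> 1" "strict_mono (r :: nat \<Rightarrow> nat)"
    "(\<lambda>n. S (x (r n))) \<longlonglongrightarrow> S w" "(\<lambda>n. A (x (r n))) \<longlonglongrightarrow> A w"
proof -
  let ?K = "Blinfun (\<lambda>x. (S x, A x))"
  have K: "?K v = (S v, A v)" for v
    by (rule bounded_linear_Blinfun_apply[THEN fun_cong])
      (intro bounded_linear_Pair blinfun.bounded_linear_right)
  let ?B = "cball (0::'a) 1"
  have "compact (closure (S ` ?B) \<times> closure (A ` ?B))"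
    using S A by (intro compact_Times) (auto simp: compact_operator_def)
  moreover have "\<forall>n. (S (x n), A (x n)) \<in> closure (S ` ?B) \<times> closure (A ` ?B)"
    using x by (auto intro!: closure_subset[THEN subsetD])
  ultimately obtain z and r :: "nat \<Rightarrow> nat" where r: "strict_mono r"
    and z: "((\<lambda>n. (S (x n), A (x n))) \<circ> r) \<longlonglongrightarrow> z"
    by (meson compact_imp_seq_compact seq_compactE)
  have lim: "(\<lambda>n. ?K (x (r n))) \<longlonglongrightarrow> z" using z by (simp add: K o_def)
  obtain w where w: "norm w \<le> 1" "?K w = z"
    using reflexive_cball_image_limit[OF refl _ lim] x by blast
  have "(\<lambda>n. (S (x (r n)), A (x (r n)))) \<longlonglongrightarrow> (S w, A w)"
    using lim w(2) by (simp add: K)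
  then show ?thesis using that[OF w(1) r] tendsto_fst tendsto_snd by fastforce
qed

section \<open>Orthogonality at a norm attainer\<close>

text \<open>Convexity: the point at \<open>s\<close> is a convex combination of those at
  \<open>0\<close> and \<open>t\<close>, so the norm cannot be at most \<open>N\<close> at
  \<open>0\<close>, at least \<open>N\<close> at \<open>s\<close> and below \<open>N\<close> at
  \<open>t\<close>.\<close>

lemma norm_ray_mono:
  fixes u v :: "'v::real_normed_vector"
  assumes "norm u \<le> N" "N \<le> norm (u + s *\<^sub>R v)" "0 < s" "s \<le> t"
  shows "N \<le> norm (u + t *\<^sub>R v)"
proof -
  have t: "t > 0" using assms by simp
  have "u + s *\<^sub>R v = (1 - s / t) *\<^sub>R u + (s / t) *\<^sub>R (u + t *\<^sub>R v)"
    using t by (simp add: algebra_simps)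
  also have "norm \<dots> \<le> norm ((1 - s / t) *\<^sub>R u) + norm ((s / t) *\<^sub>R (u + t *\<^sub>R v))"
    by (rule norm_triangle_ineq)
  also have "\<dots> = (1 - s / t) * norm u + (s / t) * norm (u + t *\<^sub>R v)"
    using assms t by (simp only: norm_scaleR) (simp add: field_simps)
  also have "\<dots> \<le> (1 - s / t) * N + (s / t) * norm (u + t *\<^sub>R v)"
    using assms t by (intro add_right_mono mult_left_mono) (auto simp: field_simps)
  finally have "(s / t) * N \<le> (s / t) * norm (u + t *\<^sub>R v)"
    using assms(2) by (simp add: algebra_simps)
  moreover have "s / t > 0" using assms t by simp
  ultimately show ?thesis by (rule mult_left_le_imp_le)
qed

text \<open>If the norm dropped in both directions, \<open>u\<close> would be a convex combination
  of two vectors of norm less than \<open>norm u\<close>.\<close>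

lemma norm_line_one_sided:
  fixes u v :: "'v::real_normed_vector"
  shows "(\<forall>t\<ge>0. norm u \<le> norm (u + t *\<^sub>R v)) \<or> (\<forall>t\<ge>0. norm u \<le> norm (u + t *\<^sub>R (- v)))"
proof (rule ccontr)
  assume "\<not> ?thesis"
  then obtain s t where s: "s \<ge> 0" "norm (u + s *\<^sub>R v) < norm u"
    and t: "t \<ge> 0" "norm (u - t *\<^sub>R v) < norm u"
    by (auto simp: not_le)
  have pos: "s > 0" "t > 0" using s t by (auto simp: less_le)
  have "(s + t) *\<^sub>R u = t *\<^sub>R (u + s *\<^sub>R v) + s *\<^sub>R (u - t *\<^sub>R v)"
    by (simp add: algebra_simps)
  then have "(s + t) * norm u \<le> t * norm (u + s *\<^sub>R v) + s * norm (u - t *\<^sub>R v)"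
    using pos norm_triangle_ineq[of "t *\<^sub>R (u + s *\<^sub>R v)" "s *\<^sub>R (u - t *\<^sub>R v)"]
    by (metis abs_of_pos add_pos_pos norm_scaleR)
  moreover have "t * norm (u + s *\<^sub>R v) < t * norm u" "s * norm (u - t *\<^sub>R v) < s * norm u"
    using pos s t by auto
  ultimately show False by (simp add: algebra_simps)
qed

lemma one_sided_orthogonal_attainer:
  fixes S A :: "'a::real_normed_vector \<Rightarrow>\<^sub>L 'b::real_normed_vector"
  assumes refl: "reflexive_space TYPE('a)"
    and S: "compact_operator S" and A: "compact_operator A"
    and attained: "\<And>t. norm_attainment_set (S + t *\<^sub>R A) \<noteq> {}"
    and orth: "\<And>t. norm S \<le> norm (S + t *\<^sub>R A)"
    and pos: "norm S > 0"
  obtains x where "x \<in> norm_attainment_set S" "\<And>t. t \<ge> 0 \<Longrightarrow> norm (S x) \<le> norm (S x + t *\<^sub>R A x)"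
proof -
  define c where "c n = inverse (real (Suc n))" for n
  have "\<exists>x. norm x = 1 \<and> norm (S x + c n *\<^sub>R A x) = norm (S + c n *\<^sub>R A)" for n
    using attained[of "c n"]
    by (auto simp: norm_attainment_set_def blinfun.add_left blinfun.scaleR_left)
  then obtain x where x: "\<And>n. norm (x n) = 1"
    and xc: "\<And>n. norm (S (x n) + c n *\<^sub>R A (x n)) = norm (S + c n *\<^sub>R A)"
    by metis
  obtain w r where w: "norm w \<le> 1" and r: "strict_mono (r :: nat \<Rightarrow> nat)"
    and Sw: "(\<lambda>n. S (x (r n))) \<longlonglongrightarrow> S w" and Aw: "(\<lambda>n. A (x (r n))) \<longlonglongrightarrow> A w"
    using compact_operators_common_limit[OF refl S A, of x] x by auto
  have c: "(\<lambda>n. c (r n)) \<longlonglongrightarrow> 0"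
    using LIMSEQ_subseq_LIMSEQ[OF LIMSEQ_inverse_real_of_nat r] by (simp add: c_def o_def)
  have ge: "norm S \<le> norm (S (x n) + c n *\<^sub>R A (x n))" for n using orth xc by simp
  have "(\<lambda>n. norm (S (x (r n)) + c (r n) *\<^sub>R A (x (r n)))) \<longlonglongrightarrow> norm (S w + 0 *\<^sub>R A w)"
    by (intro tendsto_intros Sw Aw c)
  then have "norm S \<le> norm (S w + 0 *\<^sub>R A w)"
    by (rule LIMSEQ_le_const) (use ge in auto)
  then have Sw_ge: "norm S \<le> norm (S w)" by simp
  have "norm (S w) \<le> norm S * norm w" by (rule norm_blinfun)
  \<comment> \<open>So far \<open>w\<close> is only known to lie in the unit ball;
    \<open>norm S > 0\<close> forces it onto the sphere.\<close>
  with Sw_ge have "norm S * 1 \<le> norm S * norm w" by simp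
  with pos w have nw: "norm w = 1" by (simp add: mult_le_cancel_left_pos)
  have Sw_eq: "norm (S w) = norm S"
    using norm_blinfun[of S w] nw Sw_ge by simp
  have "norm (S w) \<le> norm (S w + t *\<^sub>R A w)" if "t \<ge> 0" for t
  proof (cases "t = 0")
    case False
    with that have t: "t > 0" by simp
    \<comment> \<open>The lower bound holds at the small parameter \<open>c (r n)\<close>; convexity
      carries it out to the fixed \<open>t\<close>.\<close>
    have "norm S \<le> norm (S (x (r n)) + t *\<^sub>R A (x (r n)))" if "c (r n) < t" for n
    proof (rule norm_ray_mono[OF _ ge])
      show "norm (S (x (r n))) \<le> norm S" using norm_blinfun[of S "x (r n)"] x by simp
    qed (use that in \<open>auto simp: c_def\<close>)
    moreover have "\<forall>\<^sub>F n in sequentially. c (r n) < t" using c t by (rule order_tendstoD)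
    ultimately have "\<forall>\<^sub>F n in sequentially. norm S \<le> norm (S (x (r n)) + t *\<^sub>R A (x (r n)))"
      by (auto elim: eventually_mono)
    moreover have "(\<lambda>n. norm (S (x (r n)) + t *\<^sub>R A (x (r n)))) \<longlonglongrightarrow> norm (S w + t *\<^sub>R A w)"
      by (intro tendsto_intros Sw Aw)
    ultimately show ?thesis unfolding Sw_eq by (intro tendsto_lowerbound[of _ _ sequentially]) auto
  qed simp
  with nw Sw_eq that[of w] show ?thesis by (simp add: norm_attainment_set_def)
qed

lemma orthogonal_attainer:
  fixes S A :: "'a::real_normed_vector \<Rightarrow>\<^sub>L 'b::real_normed_vector"
  assumes refl: "reflexive_space TYPE('a)"
    and S: "compact_operator S" and A: "compact_operator A"
    and attained: "\<And>t. norm_attainment_set (S + t *\<^sub>R A) \<noteq> {}"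
    and orth: "\<And>t. norm S \<le> norm (S + t *\<^sub>R A)"
    and pos: "norm S > 0"
    and D: "connected D" "norm_attainment_set S = D \<union> uminus ` D"
  obtains x where "x \<in> norm_attainment_set S" "\<And>t. norm (S x) \<le> norm (S x + t *\<^sub>R A x)"
proof -
  define P where "P B = {x. \<forall>t\<ge>0. norm (S x) \<le> norm (S x + t *\<^sub>R blinfun_apply B x)}" for B
  have closed: "closed (P B)" for B
    unfolding P_def by (intro closed_Collect_all closed_Collect_imp closed_Collect_le
        open_Collect_const continuous_intros)
  have sym: "- x \<in> P B \<longleftrightarrow> x \<in> P B" for x B
  proof -
    have "norm (- S x - t *\<^sub>R B x) = norm (S x + t *\<^sub>R B x)" for t
      using norm_minus_cancel[of "S x + t *\<^sub>R B x"] by (simp del: norm_minus_cancel)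
    then show ?thesis by (simp add: P_def blinfun.minus_right)
  qed
  have meets: "P B \<inter> D \<noteq> {}" if B: "B = A \<or> B = - A" for B
  proof -
    have "- A = A + (- 2) *\<^sub>R A" by (simp add: scaleR_2)
    then have "compact_operator B"
      using B A compact_operator_add_scaleR[OF A A, of "- 2"] by metis
    moreover have "norm_attainment_set (S + t *\<^sub>R B) \<noteq> {} \<and> norm S \<le> norm (S + t *\<^sub>R B)" for t
      using B attained[of t] attained[of "- t"] orth[of t] orth[of "- t"] by auto
    ultimately obtain x where x: "x \<in> norm_attainment_set S"
        and "\<And>t. t \<ge> 0 \<Longrightarrow> norm (S x) \<le> norm (S x + t *\<^sub>R B x)"
      using one_sided_orthogonal_attainer[OF refl S _ _ _ pos, of B] by metis
    then have PB: "x \<in> P B" by (simp add: P_def)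
    from x D(2) consider "x \<in> D" | y where "y \<in> D" "x = - y" by blast
    then show ?thesis
    proof cases
      case 2
      with PB sym[of y B] have "y \<in> P B" by simp
      with 2(1) show ?thesis by blast
    qed (use PB in blast)
  qed
  have "x \<in> P A \<union> P (- A)" for x
    using norm_line_one_sided[of "S x" "A x"] by (simp add: P_def blinfun.minus_left)
  then have "D \<subseteq> P A \<union> P (- A)" by blast
  \<comment> \<open>Two closed sets that cover a connected set and both meet it must share a point
    of it.\<close>
  then have "P A \<inter> P (- A) \<inter> D \<noteq> {}"
    using connected_closedD[OF D(1) _ _ closed closed] meets by metis
  then obtain x where x: "x \<in> P A" "x \<in> P (- A)" "x \<in> D" by blast
  have "norm (S x) \<le> norm (S x + t *\<^sub>R A x)" for t
  proof (cases "t \<ge> 0")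
    case False
    then show ?thesis
      using x(2)[unfolded P_def mem_Collect_eq, rule_format, of "- t"]
      by (simp add: blinfun.minus_left)
  qed (use x(1) in \<open>simp add: P_def\<close>)
  with x(3) D(2) that show ?thesis by auto
qed

section \<open>Best approximation and the distance formula\<close>

lemma best_approximation_on_line:
  fixes T A :: "'v::real_normed_vector"
  obtains l where "\<And>t. norm (T + l *\<^sub>R A) \<le> norm (T + t *\<^sub>R A)"
proof (cases "A = 0")
  case False
  \<comment> \<open>For \<open>\<bar>t\<bar> > R\<close> the triangle inequality makes
    \<open>norm (T + t *\<^sub>R A)\<close> at least \<open>norm T\<close>, the value at
    \<open>0\<close>; minimising over the compact interval thus suffices.\<close>
  define R where "R = 2 * norm T / norm A"
  have "continuous_on {- R..R} (\<lambda>l. norm (T + l *\<^sub>R A))" by (intro continuous_intros)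
  moreover have "0 \<in> {- R..R}" by (simp add: R_def)
  ultimately obtain l where l: "\<And>t. t \<in> {- R..R} \<Longrightarrow> norm (T + l *\<^sub>R A) \<le> norm (T + t *\<^sub>R A)"
    using continuous_attains_inf[of "{- R..R}"] by (metis compact_Icc empty_iff)
  have "norm (T + l *\<^sub>R A) \<le> norm (T + t *\<^sub>R A)" for t
  proof (cases "t \<in> {- R..R}")
    case False
    then have "\<bar>t\<bar> > R" by auto
    then have "2 * norm T < \<bar>t\<bar> * norm A"
      using \<open>A \<noteq> 0\<close> by (simp add: R_def field_simps)
    then have "norm T \<le> norm (T + t *\<^sub>R A)"
      using norm_triangle_ineq4[of "T + t *\<^sub>R A" T] by simp
    with l[OF \<open>0 \<in> {- R..R}\<close>] show ?thesis by simp
  qed (rule l)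
  then show ?thesis by (rule that)
qed (use that in simp)

text \<open>Since \<open>p (A x) y = 0\<close>, replacing \<open>T\<close> by
  \<open>T + l *\<^sub>R A\<close> leaves the value unchanged; Cauchy-Schwarz then bounds
  it.\<close>

lemma sip_values_le:
  fixes T A :: "'a::real_normed_vector \<Rightarrow>\<^sub>L 'b::real_normed_vector"
  assumes "v \<in> sip_values T A"
  shows "v \<le> norm (T + l *\<^sub>R A)"
proof -
  obtain x y p where v: "v = p (T x) y" "norm x = 1" "norm y = 1" "p (A x) y = 0"
    and p: "semi_inner_product p" "\<And>x. p x x = (norm x)\<^sup>2"
    using assms by (auto simp: sip_values_def compatible_sips_def)
  have "p (1 *\<^sub>R T x + l *\<^sub>R A x) y = 1 * p (T x) y + l * p (A x) y"
    using p(1) unfolding semi_inner_product_def by blast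
  with v have v_eq: "v = p ((T + l *\<^sub>R A) x) y"
    by (simp add: blinfun.add_left blinfun.scaleR_left)
  have "\<bar>v\<bar>\<^sup>2 \<le> p ((T + l *\<^sub>R A) x) ((T + l *\<^sub>R A) x) * p y y"
    using p(1) unfolding v_eq semi_inner_product_def by blast
  also have "\<dots> = (norm ((T + l *\<^sub>R A) x))\<^sup>2"
    unfolding p(2) v(3) by simp
  finally have "\<bar>v\<bar> \<le> norm ((T + l *\<^sub>R A) x)"
    by (rule power2_le_imp_le) simp
  also have "\<dots> \<le> norm (T + l *\<^sub>R A)"
    using norm_blinfun[of "T + l *\<^sub>R A" x] v(2) by simp
  finally show ?thesis by simp
qed

theorem theorem2p9:
  fixes T A :: "'a::banach \<Rightarrow>\<^sub>L 'b::banach"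
  assumes "reflexive_space TYPE('a)"
    and "compact_operator T"
    and "compact_operator A"
    and "\<And>l::real. \<exists>D. D \<noteq> {} \<and> connected D \<and> D \<subseteq> sphere 0 1 \<and>
           norm_attainment_set (T + l *\<^sub>R A) = D \<union> uminus ` D"
  shows "infdist T (span {A}) = Sup0 (sip_values T A)"
proof -
  obtain l where l: "\<And>t. norm (T + l *\<^sub>R A) \<le> norm (T + t *\<^sub>R A)"
    using best_approximation_on_line[of T A] by blast
  define S where "S = T + l *\<^sub>R A"
  have dist: "infdist T (span {A}) = norm S"
    unfolding infdist_span_singleton S_def
    by (rule cInf_eq_minimum) (use l in auto)
  have upper: "v \<le> norm S" if "v \<in> sip_values T A" for v
    using sip_values_le[OF that] by (simp add: S_def)
  show ?thesis
  proof (cases "norm S = 0")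
    case True
    \<comment> \<open>The value set is symmetric, so the upper bound \<open>0\<close> also bounds it
      from below. It may still be empty, where \<open>Sup0\<close> gives \<open>0\<close>.\<close>
    have "v = 0" if "v \<in> sip_values T A" for v
      using upper[OF that] upper[OF uminus_in_sip_values[OF that]] True by simp
    then have "sip_values T A = {} \<or> sip_values T A = {0}" by blast
    then show ?thesis using True dist by (elim disjE) (simp_all add: Sup0_def)
  next
    case False
    then have pos: "norm S > 0" by simp
    have shift: "S + t *\<^sub>R A = T + (l + t) *\<^sub>R A" for t
      by (simp add: S_def algebra_simps)
    have attained: "norm_attainment_set (S + t *\<^sub>R A) \<noteq> {}" for t
      using assms(4)[of "l + t"] by (auto simp: shift)
    have orth: "norm S \<le> norm (S + t *\<^sub>R A)" for t
      using l by (simp add: shift) (simp add: S_def)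
    have S: "compact_operator S"
      unfolding S_def using assms(2,3) by (rule compact_operator_add_scaleR)
    obtain D where "connected D" "norm_attainment_set S = D \<union> uminus ` D"
      using assms(4)[of l] by (auto simp: S_def)
    then obtain x where x: "x \<in> norm_attainment_set S"
      and xo: "\<And>t. norm (S x) \<le> norm (S x + t *\<^sub>R A x)"
      using orthogonal_attainer[OF assms(1) S assms(3) attained orth pos] by metis
    have nx: "norm x = 1" "norm (S x) = norm S" using x by (auto simp: norm_attainment_set_def)
    obtain h :: "'b \<Rightarrow>\<^sub>L real" where h: "norm h \<le> 1" "h (S x) = norm (S x)" "h (A x) = 0"
      using orthogonal_support_functional[OF xo] by blast
    define y where "y = S x /\<^sub>R norm (S x)"
    have y: "norm y = 1" using pos nx by (simp add: y_def)
    have "h y = norm y" unfolding y using pos nx h(2) by (simp add: y_def blinfun.scaleR_right)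
    then obtain p where p: "p \<in> compatible_sips" "\<And>z. p z y = h z"
      using semi_inner_product_with_functional[OF h(1) _ y] by blast
    \<comment> \<open>\<open>T x\<close> and \<open>S x\<close> differ by a multiple of
      \<open>A x\<close>, which \<open>h\<close> annihilates.\<close>
    have "h (T x) = norm S"
      using h(2,3) nx by (simp add: S_def blinfun.add_left blinfun.scaleR_left blinfun.add_right blinfun.scaleR_right)
    then have "norm S \<in> sip_values T A"
      unfolding sip_values_def using nx y p h(3) by (intro CollectI exI[of _ x] exI[of _ y] exI[of _ p]) auto
    then have "Sup (sip_values T A) = norm S" "sip_values T A \<noteq> {}"
      using upper by (auto intro: cSup_eq_maximum)
    then show ?thesis by (simp add: dist Sup0_def)
  qed
qed

end
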